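(* Let $\alpha>-5/6$ and $\beta=-\frac{1+2\alpha}{2}$. If $\alpha\ne-\frac12$, then $$(1-3\bar Z X+3ZX^2-X^3)^{\beta}=\sum_{n\ge0}c_n\,P^{(\alpha)}_{0,n}(Z,\bar Z)\,X^n,\qquad c_n=(-3)^n\,\frac{\beta(\beta-1)\cdots(\beta-n+1)}{n!},$$ as a power series in $X$ around $X=0$. If $\alpha=-\frac12$, then $\log(1-3\bar ZX+3ZX^2-X^3)=\sum_{n\ge1}c_n\,P^{(-1/2)}_{0,n}(Z,\bar Z)\,X^n$ for some nonzero constants $c_n$.
   Context: $Z,\bar Z$ are treated as two independent variables (conjugate complex coordinates); powers and logarithms are formal power series in $X$ with coefficients in $\mathbb{C}[Z,\bar Z]$ (equivalently, convergent expansions for small $|X|$ when $Z,\bar Z$ are bounded). With $\lambda=\frac12(6\alpha+5)$, the polynomials $P_{p,q}=P^{(\alpha)}_{p,q}(Z,\bar Z)$, $p,q\ge0$, are defined inductively by $P_{0,0}=1$, $P_{0,1}=\bar Z$, $P_{1,0}=Z$ and $$P_{p+1,q}=Z P_{p,q}+a_1(\lambda,p)P_{p-1,q+1}+a_2(\lambda,p,q)P_{p,q-1},\quad P_{p,q+1}=\bar Z P_{p,q}+a_1(\lambda,q)P_{p+1,q-1}+a_2(\lambda,q,p)P_{p-1,q},$$ where $$a_1(\lambda,p)=-\frac{p(3p+2\lambda-5)}{(\lambda+3p-1)(\lambda+3p-4)},\quad a_2(\lambda,p,q)=-\frac{q(3q+2\lambda-5)(\lambda+3(p+q)-1)(\lambda+p+q-2)}{(\lambda+3q-1)(2\lambda+3(p+q)-5)(2\lambda+3(p+q)-2)(\lambda+3q-4)},$$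 with $a_1(\lambda,0)=a_2(\lambda,p,0)=0$ and, when a denominator vanishes, the value being the limit as $\epsilon\to0$ of the same expression at $\lambda+\epsilon$. $P_{p,q}$ has the form $Z^p\bar Z^q+$ lower degree terms, and is an eigenvector, with eigenvalue $-[(\lambda-1)(p+q)+p^2+q^2+pq]$, of the operator $L^{(\alpha)}=(\bar Z-Z^2)\partial_Z^2+(1-Z\bar Z)\partial_Z\partial_{\bar Z}+(Z-\bar Z^2)\partial_{\bar Z}^2-\lambda(Z\partial_Z+\bar Z\partial_{\bar Z})$. *)

theory Defs
  imports Complex_Main "HOL-Computational_Algebra.Computational_Algebra"
begin

text \<open>
  Throughout, \<open>l\<close> stands for the parameter \<open>\<lambda>\<close>. The suffix \<open>_expr\<close> marks the plain rational
  expressions, which are junk (division by zero) where a denominator vanishes; \<open>a1\<close> and \<open>a2\<close> are the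
  actual recurrence coefficients, where such values are replaced by limits in \<open>\<lambda>\<close>.
\<close>

definition a1_expr :: "real \<Rightarrow> nat \<Rightarrow> real" where
  "a1_expr l p =
     - (real p * (3 * real p + 2 * l - 5)) / ((l + 3 * real p - 1) * (l + 3 * real p - 4))"

definition a1 :: "real \<Rightarrow> nat \<Rightarrow> real" where
  "a1 l p =
     (if p = 0 then 0
      else if (l + 3 * real p - 1) * (l + 3 * real p - 4) = 0
        then Lim (at 0) (\<lambda>\<epsilon>. a1_expr (l + \<epsilon>) p)
      else a1_expr l p)"

definition a2_expr :: "real \<Rightarrow> nat \<Rightarrow> nat \<Rightarrow> real" where
  "a2_expr l p q =
     - (real q * (3 * real q + 2 * l - 5) * (l + 3 * (real p + real q) - 1)
          * (l + real p + real q - 2)) /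
       ((l + 3 * real q - 1) * (2 * l + 3 * (real p + real q) - 5)
          * (2 * l + 3 * (real p + real q) - 2) * (l + 3 * real q - 4))"

definition a2 :: "real \<Rightarrow> nat \<Rightarrow> nat \<Rightarrow> real" where
  "a2 l p q =
     (if q = 0 then 0
      else if (l + 3 * real q - 1) * (2 * l + 3 * (real p + real q) - 5)
                * (2 * l + 3 * (real p + real q) - 2) * (l + 3 * real q - 4) = 0
        then Lim (at 0) (\<lambda>\<epsilon>. a2_expr (l + \<epsilon>) p q)
      else a2_expr l p q)"

text \<open>
  The ring \<open>\<complex>[Z, Zbar]\<close> is modelled as \<open>complex poly poly\<close>: polynomials in \<open>Z\<close> whose coefficients are
  polynomials in \<open>Zbar\<close>. The two variables are independent.
\<close>

definition Zvar :: "complex poly poly" where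
  "Zvar = [:0, 1:]"

definition Zbar :: "complex poly poly" where
  "Zbar = [:[:0, 1:]:]"

definition scalar :: "complex \<Rightarrow> complex poly poly" where
  "scalar c = [:[:c:]:]"

definition lam :: "real \<Rightarrow> real" where
  "lam \<alpha> = (6 * \<alpha> + 5) / 2"

text \<open>
  The defining recurrences overlap: \<open>P (p + 1) (q + 1)\<close> can be computed by raising either index.
  The recursion below raises \<open>p\<close> whenever possible; lemmas \<open>deltoid_poly_rec1\<close> and
  \<open>deltoid_poly_rec2\<close> at the end show that both recurrences hold for all \<open>p\<close> and \<open>q\<close>
  if \<open>\<alpha> > -5/6\<close>. Terms with an index \<open>-1\<close> have coefficient \<open>0\<close> and are left out.
\<close>

function deltoid_poly :: "real \<Rightarrow> nat \<Rightarrow> nat \<Rightarrow> complex poly poly" where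
  "deltoid_poly \<alpha> 0 0 = 1"
| "deltoid_poly \<alpha> (Suc p) q =
     Zvar * deltoid_poly \<alpha> p q
     + (if p = 0 then 0
        else scalar (of_real (a1 (lam \<alpha>) p)) * deltoid_poly \<alpha> (p - 1) (q + 1))
     + (if q = 0 then 0
        else scalar (of_real (a2 (lam \<alpha>) p q)) * deltoid_poly \<alpha> p (q - 1))"
| "deltoid_poly \<alpha> 0 (Suc q) =
     Zbar * deltoid_poly \<alpha> 0 q
     + (if q = 0 then 0
        else scalar (of_real (a1 (lam \<alpha>) q)) * deltoid_poly \<alpha> 1 (q - 1))"
  by pat_completeness auto
termination
  by (relation "measure (\<lambda>(\<alpha>, p, q). p + q)") auto

definition scalar_fps :: "complex fps \<Rightarrow> complex poly poly fps" where
  "scalar_fps F = Abs_fps (\<lambda>n. scalar (fps_nth F n))"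

text \<open>
  Formal powers and logarithms of a series \<open>F\<close> with constant term \<open>1\<close>, by substituting \<open>F - 1\<close>
  into the series of \<open>(1 + x)^\<beta>\<close> and \<open>log (1 + x)\<close>.
\<close>

definition fps_power_real :: "complex poly poly fps \<Rightarrow> real \<Rightarrow> complex poly poly fps" where
  "fps_power_real F \<beta> = scalar_fps (fps_binomial (of_real \<beta>)) oo (F - 1)"

definition fps_log :: "complex poly poly fps \<Rightarrow> complex poly poly fps" where
  "fps_log F = scalar_fps (fps_ln 1) oo (F - 1)"

definition deltoid_gen :: "complex poly poly fps" where
  "deltoid_gen = 1 - 3 * fps_const Zbar * fps_X + 3 * fps_const Zvar * fps_X ^ 2 - fps_X ^ 3"

subsection \<open>Consistency of the two recurrences\<close>

definition S_expr :: "real \<Rightarrow> nat \<Rightarrow> real" where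
  "S_expr l n = (l + 3 * real n - 1) * (l + real n - 2) /
     ((2 * l + 3 * real n - 5) * (2 * l + 3 * real n - 2))"

lemma a2_expr_factor: "a2_expr l p q = a1_expr l q * S_expr l (p + q)"
  by (simp add: a2_expr_def a1_expr_def S_expr_def mult_ac add_ac)

lemma partial_fractions:
  fixes x y :: real
  assumes nz: "x \<noteq> 0" "x - 3 \<noteq> 0" "y \<noteq> 0" "y + 3 \<noteq> 0"
    "x + y - 3 \<noteq> 0" "x + y \<noteq> 0" "x + y + 3 \<noteq> 0"
  shows "1 / (x * (x - 3)) * (1 / (y * (y + 3))) - 1 / (x * (x - 3)) * (1 / ((x + y) * (x + y - 3)))
           - 1 / (y * (y + 3)) * (1 / ((x + y) * (x + y + 3))) =
         2 / (x * y * ((x + y - 3) * (x + y + 3)))"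
proof -
  define s where "s = x + y"
  let ?D = "x * (x - 3) * y * (y + 3) * s * (s - 3) * (s + 3)"
  have nz': "s \<noteq> 0" "s - 3 \<noteq> 0" "s + 3 \<noteq> 0" using nz by (simp_all add: s_def)
  have 1: "1 / (x * (x - 3)) * (1 / (y * (y + 3))) = s * (s - 3) * (s + 3) / ?D"
    using nz nz' by simp
  have 2: "1 / (x * (x - 3)) * (1 / (s * (s - 3))) = y * (y + 3) * (s + 3) / ?D"
    using nz nz' by simp
  have 3: "1 / (y * (y + 3)) * (1 / (s * (s + 3))) = x * (x - 3) * (s - 3) / ?D"
    using nz nz' by simp
  have 4: "2 / (x * y * ((s - 3) * (s + 3))) = 2 * (s * (x - 3) * (y + 3)) / ?D"
  proof -
    have "c / (x * y * ((s - 3) * (s + 3))) = c * (s * (x - 3) * (y + 3)) / ?D" for c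
      using nz nz' by simp
    then show ?thesis .
  qed
  have "s * (s - 3) * (s + 3) - y * (y + 3) * (s + 3) - x * (x - 3) * (s - 3)
          = 2 * (s * (x - 3) * (y + 3))"
    unfolding s_def by algebra
  then show ?thesis
    unfolding s_def[symmetric] 1 2 3 4 by (simp only: diff_divide_distrib[symmetric])
qed

lemma expr_identity:
  fixes l :: real
  assumes "l + 3 * real p - 1 \<noteq> 0" "l + 3 * real p - 4 \<noteq> 0" "l + 3 * real p + 2 \<noteq> 0"
    "l + 3 * real q - 1 \<noteq> 0" "l + 3 * real q - 4 \<noteq> 0" "l + 3 * real q + 2 \<noteq> 0"
    "2 * l + 3 * (real p + real q) - 5 \<noteq> 0" "2 * l + 3 * (real p + real q) - 2 \<noteq> 0"
    "2 * l + 3 * (real p + real q) + 1 \<noteq> 0"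
  shows "a2_expr l q p + a1_expr l p * a1_expr l (Suc q) + a2_expr l p (Suc q) =
         a2_expr l p q + a1_expr l q * a1_expr l (Suc p) + a2_expr l q (Suc p)"
proof -
  define x y where "x = l + 3 * real p - 1" and "y = l + 3 * real q - 1"
  have e: "real p = (x - l + 1) / 3" "real q = (y - l + 1) / 3"
      "real (Suc p) = (x - l + 4) / 3" "real (Suc q) = (y - l + 4) / 3"
    by (simp_all add: x_def y_def field_simps)
  have d: "l + 3 * real p - 1 = x" "l + 3 * real p - 4 = x - 3" "3 * real p + 2 * l - 5 = x + l - 4"
      "l + 3 * real q - 1 = y" "l + 3 * real q - 4 = y - 3" "3 * real q + 2 * l - 5 = y + l - 4"
      "l + 3 * real (Suc p) - 1 = x + 3" "l + 3 * real (Suc p) - 4 = x"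
      "3 * real (Suc p) + 2 * l - 5 = x + l - 1"
      "l + 3 * real (Suc q) - 1 = y + 3" "l + 3 * real (Suc q) - 4 = y"
      "3 * real (Suc q) + 2 * l - 5 = y + l - 1"
    by (simp_all add: x_def y_def)
  have nz: "x \<noteq> 0" "x - 3 \<noteq> 0" "x + 3 \<noteq> 0" "y \<noteq> 0" "y - 3 \<noteq> 0" "y + 3 \<noteq> 0"
    "x + y - 3 \<noteq> 0" "x + y \<noteq> 0" "x + y + 3 \<noteq> 0"
    using assms by (auto simp: x_def y_def algebra_simps)
  define k where "k = (l - 1) * (l - 4)"
  define u u' v v' w w' where "u = 1 / (x * (x - 3))" and "u' = 1 / (x * (x + 3))"
    and "v = 1 / (y * (y - 3))" and "v' = 1 / (y * (y + 3))"
    and "w = 1 / ((x + y) * (x + y - 3))" and "w' = 1 / ((x + y) * (x + y + 3))"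
  note uvw = u_def u'_def v_def v'_def w_def w'_def
  have N: "(x - l + 1) * (x + l - 4) = x * (x - 3) - k" "(x - l + 4) * (x + l - 1) = x * (x + 3) - k" for x
    unfolding k_def by algebra+
  have Q: "(d - k) / d = 1 - k * (1 / d)" if "d \<noteq> 0" for d :: real
    using that by (simp add: diff_divide_distrib)
  have R: "- (a / 3 * b) / d = - ((a * b) / d) / 3" "(a * (b / 3)) / d = (a * b) / d / 3"
    for a b d :: real by simp_all
  have A: "a1_expr l p = - (1 - k * u) / 3" "a1_expr l q = - (1 - k * v) / 3"
     "a1_expr l (Suc p) = - (1 - k * u') / 3" "a1_expr l (Suc q) = - (1 - k * v') / 3"
    unfolding a1_expr_def d unfolding e R N uvw mult.commute[of _ x] mult.commute[of _ y]
    using nz by (simp_all add: Q mult.commute)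
  have n: "l + 3 * real (p + q) - 1 = x + y - l + 1" "l + real (p + q) - 2 = (x + y + l - 4) / 3"
      "2 * l + 3 * real (p + q) - 5 = x + y - 3" "2 * l + 3 * real (p + q) - 2 = x + y"
      "l + 3 * real (Suc (p + q)) - 1 = x + y - l + 4"
      "l + real (Suc (p + q)) - 2 = (x + y + l - 1) / 3"
      "2 * l + 3 * real (Suc (p + q)) - 5 = x + y"
      "2 * l + 3 * real (Suc (p + q)) - 2 = x + y + 3"
    by (simp_all add: x_def y_def field_simps)
  have B: "S_expr l (p + q) = (1 - k * w) / 3" "S_expr l (Suc (p + q)) = (1 - k * w') / 3"
    unfolding S_expr_def n R N uvw mult.commute[of "x + y - 3" "x + y"] using nz by (simp_all add: Q)
  have "u * v' - u * w - v' * w' = 2 / (x * y * ((x + y - 3) * (x + y + 3)))"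
    unfolding uvw by (rule partial_fractions) (use nz in auto)
  moreover have "v * u' - v * w - u' * w' = 2 / (y * x * ((y + x - 3) * (y + x + 3)))"
    unfolding uvw add.commute[of x y] by (rule partial_fractions) (use nz in auto)
  ultimately have E: "u * v' - u * w - v' * w' = v * u' - v * w - u' * w'"
    by (simp add: mult.commute add.commute)
  have C: "q + p = p + q" "p + Suc q = Suc (p + q)" "q + Suc p = Suc (p + q)" by simp_all
  have "a1_expr l p * S_expr l (p + q) + a1_expr l p * a1_expr l (Suc q)
          + a1_expr l (Suc q) * S_expr l (Suc (p + q)) =
        a1_expr l q * S_expr l (p + q) + a1_expr l q * a1_expr l (Suc p)
          + a1_expr l (Suc p) * S_expr l (Suc (p + q))"
  proof -
    have F: "- (1 - k * a) / 3 * ((1 - k * w) / 3) + - (1 - k * a) / 3 * (- (1 - k * b) / 3)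
            + - (1 - k * b) / 3 * ((1 - k * w') / 3)
          = (k * (w + w') - 1 + k ^ 2 * (a * b - a * w - b * w')) / 9" for a b
      by (simp add: field_simps power2_eq_square)
    show ?thesis unfolding A B F E ..
  qed
  then show ?thesis unfolding a2_expr_factor C .
qed

lemma tendsto_a1:
  assumes "l > 0"
  shows "((\<lambda>\<epsilon>. a1_expr (l + \<epsilon>) p) \<longlongrightarrow> a1 l p) (at 0)"
proof (cases "p = 0")
  case True
  then show ?thesis by (simp add: a1_def a1_expr_def)
next
  case p: False
  show ?thesis
  proof (cases "(l + 3 * real p - 1) * (l + 3 * real p - 4) = 0")
    case False
    then have "((\<lambda>\<epsilon>. a1_expr (l + \<epsilon>) p) \<longlongrightarrow> a1_expr (l + 0) p) (at 0)"
      unfolding a1_expr_def by (intro tendsto_intros) auto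
    then show ?thesis using False p by (simp add: a1_def)
  next
    case True
    have "real p \<ge> 1" using p by linarith
    then have eq: "l + 3 * real p = 4" using True assms by auto
    then have "real p < 2" using assms by linarith
    then have p1: "p = 1" using p by linarith
    then have l1: "l = 1" using eq by simp
    have "((\<lambda>\<epsilon>::real. - 2 / (3 + \<epsilon>)) \<longlongrightarrow> - 2 / (3 + 0)) (at 0)"
      by (intro tendsto_intros) auto
    moreover have "eventually (\<lambda>\<epsilon>. - 2 / (3 + \<epsilon>) = a1_expr (l + \<epsilon>) p) (at 0)"
      using eventually_neq_at_within[of 0]
      by eventually_elim (simp add: a1_expr_def p1 l1)
    ultimately have "((\<lambda>\<epsilon>. a1_expr (l + \<epsilon>) p) \<longlongrightarrow> - 2 / (3 + 0)) (at 0)"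
      by (rule Lim_transform_eventually)
    then show ?thesis using True p by (simp add: a1_def tendsto_Lim)
  qed
qed

lemma tendsto_a2:
  assumes "l > 0"
  shows "((\<lambda>\<epsilon>. a2_expr (l + \<epsilon>) p q) \<longlongrightarrow> a2 l p q) (at 0)"
proof (cases "q = 0")
  case True
  then show ?thesis by (simp add: a2_def a2_expr_def)
next
  case q: False
  let ?D = "(l + 3 * real q - 1) * (2 * l + 3 * (real p + real q) - 5)
              * (2 * l + 3 * (real p + real q) - 2) * (l + 3 * real q - 4)"
  show ?thesis
  proof (cases "?D = 0")
    case False
    then have "((\<lambda>\<epsilon>. a2_expr (l + \<epsilon>) p q) \<longlongrightarrow> a2_expr (l + 0) p q) (at 0)"
      unfolding a2_expr_def by (intro tendsto_intros) auto
    then show ?thesis using False q by (simp add: a2_def)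
  next
    case True
    have q1: "real q \<ge> 1" using q by linarith
    have "l = 1 \<and> q = 1"
    proof (cases "l + 3 * real q = 4")
      case t: True
      then have "real q < 2" using assms by linarith
      then have "q = 1" using q by linarith
      then show ?thesis using t by simp
    next
      case False
      then have t: "2 * l + 3 * (real p + real q) = 5" using True assms q1 by auto
      then have "real (p + q) < 2" unfolding of_nat_add using assms by argo
      then have "q = 1" "p = 0" using q by linarith+
      then show ?thesis using t by simp
    qed
    then have l1: "l = 1" and q1: "q = 1" by auto
    have "\<exists>L. ((\<lambda>\<epsilon>. S_expr (l + \<epsilon>) (p + q)) \<longlongrightarrow> L) (at 0)"
    proof (cases "p = 0")
      case True
      have lim: "((\<lambda>\<epsilon>::real. (3 + \<epsilon>) / (2 * (2 * \<epsilon> + 3))) \<longlongrightarrow> (3 + 0) / (2 * (2 * 0 + 3))) (at 0)"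
        by (intro tendsto_intros) auto
      have S: "S_expr (l + \<epsilon>) (p + q) = (\<epsilon> * (3 + \<epsilon>)) / (\<epsilon> * (2 * (2 * \<epsilon> + 3)))" for \<epsilon>
        by (simp add: S_expr_def True l1 q1 algebra_simps)
      have ev: "eventually (\<lambda>\<epsilon>. (3 + \<epsilon>) / (2 * (2 * \<epsilon> + 3)) = S_expr (l + \<epsilon>) (p + q)) (at 0)"
        using eventually_neq_at_within[of 0]
        by eventually_elim (simp add: S)
      show ?thesis using Lim_transform_eventually[OF lim ev] by blast
    next
      case False
      then have "((\<lambda>\<epsilon>. S_expr (l + \<epsilon>) (p + q)) \<longlongrightarrow> S_expr (l + 0) (p + q)) (at 0)"
        unfolding S_expr_def l1 q1 by (intro tendsto_intros) auto
      then show ?thesis by blast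
    qed
    then obtain L where "((\<lambda>\<epsilon>. S_expr (l + \<epsilon>) (p + q)) \<longlongrightarrow> L) (at 0)" by blast
    then have "((\<lambda>\<epsilon>. a2_expr (l + \<epsilon>) p q) \<longlongrightarrow> a1 l q * L) (at 0)"
      unfolding a2_expr_factor by (intro tendsto_mult tendsto_a1 assms)
    then show ?thesis using True q by (simp add: a2_def tendsto_Lim)
  qed
qed

lemma coeff_identity0:
  assumes "l > 0"
  shows "a2 l q p + a1 l p * a1 l (Suc q) + a2 l p (Suc q) =
         a2 l p q + a1 l q * a1 l (Suc p) + a2 l q (Suc p)"
proof (rule tendsto_unique)
  let ?f = "\<lambda>\<epsilon>. a2_expr (l + \<epsilon>) q p + a1_expr (l + \<epsilon>) p * a1_expr (l + \<epsilon>) (Suc q)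
              + a2_expr (l + \<epsilon>) p (Suc q)"
  let ?g = "\<lambda>\<epsilon>. a2_expr (l + \<epsilon>) p q + a1_expr (l + \<epsilon>) q * a1_expr (l + \<epsilon>) (Suc p)
              + a2_expr (l + \<epsilon>) q (Suc p)"
  show "(?f \<longlongrightarrow> a2 l q p + a1 l p * a1 l (Suc q) + a2 l p (Suc q)) (at 0)"
    by (intro tendsto_intros tendsto_a1 tendsto_a2 assms)
  have *: "(?g \<longlongrightarrow> a2 l p q + a1 l q * a1 l (Suc p) + a2 l q (Suc p)) (at 0)"
    by (intro tendsto_intros tendsto_a1 tendsto_a2 assms)
  have "eventually (\<lambda>\<epsilon>. ?g \<epsilon> = ?f \<epsilon>) (at 0)"
    using eventually_neq_at_within[of "1 - 3 * real p - l" 0 UNIV]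
      eventually_neq_at_within[of "4 - 3 * real p - l" 0 UNIV]
      eventually_neq_at_within[of "- 2 - 3 * real p - l" 0 UNIV]
      eventually_neq_at_within[of "1 - 3 * real q - l" 0 UNIV]
      eventually_neq_at_within[of "4 - 3 * real q - l" 0 UNIV]
      eventually_neq_at_within[of "- 2 - 3 * real q - l" 0 UNIV]
      eventually_neq_at_within[of "(5 - 3 * (real p + real q)) / 2 - l" 0 UNIV]
      eventually_neq_at_within[of "(2 - 3 * (real p + real q)) / 2 - l" 0 UNIV]
      eventually_neq_at_within[of "(- 1 - 3 * (real p + real q)) / 2 - l" 0 UNIV]
    by eventually_elim (rule sym, rule expr_identity, auto simp: field_simps)
  with * show "(?f \<longlongrightarrow> a2 l p q + a1 l q * a1 l (Suc p) + a2 l q (Suc p)) (at 0)"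
    by (rule Lim_transform_eventually)
qed simp

lemma coeff_identity1:
  assumes "l > 0"
  shows "a2 l q (Suc p) * a1 l p = a1 l (Suc p) * a2 l (Suc q) p"
proof (rule tendsto_unique)
  let ?f = "\<lambda>\<epsilon>. a2_expr (l + \<epsilon>) q (Suc p) * a1_expr (l + \<epsilon>) p"
  show "(?f \<longlongrightarrow> a2 l q (Suc p) * a1 l p) (at 0)"
    by (intro tendsto_intros tendsto_a1 tendsto_a2 assms)
  have "((\<lambda>\<epsilon>. a1_expr (l + \<epsilon>) (Suc p) * a2_expr (l + \<epsilon>) (Suc q) p)
           \<longlongrightarrow> a1 l (Suc p) * a2 l (Suc q) p) (at 0)"
    by (intro tendsto_intros tendsto_a1 tendsto_a2 assms)
  then show "(?f \<longlongrightarrow> a1 l (Suc p) * a2 l (Suc q) p) (at 0)"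
    by (simp add: a2_expr_factor mult_ac)
qed simp

lemma coeff_identity2:
  assumes "l > 0"
  shows "a2 l (Suc q) (Suc p) * a2 l p (Suc q) = a2 l (Suc p) (Suc q) * a2 l q (Suc p)"
proof (rule tendsto_unique)
  let ?f = "\<lambda>\<epsilon>. a2_expr (l + \<epsilon>) (Suc q) (Suc p) * a2_expr (l + \<epsilon>) p (Suc q)"
  show "(?f \<longlongrightarrow> a2 l (Suc q) (Suc p) * a2 l p (Suc q)) (at 0)"
    by (intro tendsto_intros tendsto_a1 tendsto_a2 assms)
  have "((\<lambda>\<epsilon>. a2_expr (l + \<epsilon>) (Suc p) (Suc q) * a2_expr (l + \<epsilon>) q (Suc p))
           \<longlongrightarrow> a2 l (Suc p) (Suc q) * a2 l q (Suc p)) (at 0)"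
    by (intro tendsto_intros tendsto_a1 tendsto_a2 assms)
  then show "(?f \<longlongrightarrow> a2 l (Suc p) (Suc q) * a2 l q (Suc p)) (at 0)"
    by (simp add: a2_expr_factor mult_ac add_ac)
qed simp

abbreviation (input) rscalar :: "real \<Rightarrow> complex poly poly" where
  "rscalar c \<equiv> scalar (of_real c)"

lemma rscalar_hom:
  "rscalar (a + b) = rscalar a + rscalar b" "rscalar (a * b) = rscalar a * rscalar b"
  "scalar 0 = 0"
  by (simp_all add: scalar_def)

text \<open>Out-of-range indices are harmless below since \<open>a1 l 0 = a2 l p 0 = 0\<close>.\<close>

lemma deltoid_poly_rec1:
  "deltoid_poly \<alpha> (p + 1) q =
     Zvar * deltoid_poly \<alpha> p q
     + scalar (of_real (a1 (lam \<alpha>) p)) * deltoid_poly \<alpha> (p - 1) (q + 1)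
     + scalar (of_real (a2 (lam \<alpha>) p q)) * deltoid_poly \<alpha> p (q - 1)"
  by (simp add: a1_def a2_def scalar_def)

lemma consistency_step:
  fixes Z B :: "'a :: idom"
  assumes "P11 = Z * P01 + am * V + b1 * P00"
    and "P10 = Z * P00 + am * V1 + b0 * W"
    and "P01 = B * P00 + aq * T1 + d0 * U"
    and "aq * T = aq * (Z * T1 + am1 * P00 + e * R)"
    and "am * V = am * (B * V1 + aq1 * P00 + f * S)"
    and "d0 * P00 = d0 * (Z * U + amm * S + g * Y)"
    and "b0 * P00 = b0 * (B * W + aqm * R + h * Y)"
    and "d0 * amm = am * f"
    and "b0 * aqm = aq * e"
    and "d0 * g = b0 * h"
    and "d0 + am * aq1 + b1 = b0 + aq * am1 + d1"
  shows "P11 = B * P10 + aq * T + d1 * P00"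
  using assms by algebra

lemma deltoid_poly_rec2:
  assumes "\<alpha> > - 5 / 6"
  shows "deltoid_poly \<alpha> p (q + 1) =
     Zbar * deltoid_poly \<alpha> p q
     + scalar (of_real (a1 (lam \<alpha>) q)) * deltoid_poly \<alpha> (p + 1) (q - 1)
     + scalar (of_real (a2 (lam \<alpha>) q p)) * deltoid_poly \<alpha> (p - 1) q"
proof -
  define l P where "l = lam \<alpha>" and "P = deltoid_poly \<alpha>"
  have l: "l > 0" using assms by (simp add: l_def lam_def)
  have z [simp]: "a1 l 0 = 0" "a2 l n 0 = 0" for n by (simp_all add: a1_def a2_def)
  note rec1 = deltoid_poly_rec1[of \<alpha>, folded l_def P_def]
  have rec20: "P 0 (q + 1) = Zbar * P 0 q + rscalar (a1 l q) * P 1 (q - 1)" for q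
    by (simp add: P_def l_def a1_def scalar_def)
  have id0: "rscalar (a2 l q p) + rscalar (a1 l p) * rscalar (a1 l (Suc q)) + rscalar (a2 l p (Suc q)) =
         rscalar (a2 l p q) + rscalar (a1 l q) * rscalar (a1 l (Suc p)) + rscalar (a2 l q (Suc p))" for p q
    using arg_cong[OF coeff_identity0[OF l, of q p], of rscalar] by (simp only: rscalar_hom)
  have id1: "rscalar (a2 l q (Suc p)) * rscalar (a1 l p) = rscalar (a1 l (Suc p)) * rscalar (a2 l (Suc q) p)" for p q
    using arg_cong[OF coeff_identity1[OF l, of q p], of rscalar] by (simp only: rscalar_hom)
  have id2: "rscalar (a2 l (Suc q) (Suc p)) * rscalar (a2 l p (Suc q)) =
         rscalar (a2 l (Suc p) (Suc q)) * rscalar (a2 l q (Suc p))" for p q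
    using arg_cong[OF coeff_identity2[OF l, of q p], of rscalar] by (simp only: rscalar_hom)
  have "P p (q + 1) = Zbar * P p q + rscalar (a1 l q) * P (p + 1) (q - 1)
          + rscalar (a2 l q p) * P (p - 1) q" for p q
  proof (induction "p + q" arbitrary: p q rule: less_induct)
    case less
    show ?case
    proof (cases p)
      case 0
      then show ?thesis using rec20[of q] by (simp add: rscalar_hom)
    next
      case (Suc m)
      have IH: "P p' (q' + 1) = Zbar * P p' q' + rscalar (a1 l q') * P (p' + 1) (q' - 1)
          + rscalar (a2 l q' p') * P (p' - 1) q'" if "p' + q' \<le> m + q" for p' q'
        using less that Suc by simp
      have "P (m + 1) (q + 1) = Zbar * P (m + 1) q + rscalar (a1 l q) * P (m + 2) (q - 1)
          + rscalar (a2 l q (Suc m)) * P m q"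
      proof (rule consistency_step)
        show "P (m + 1) (q + 1) = Zvar * P m (q + 1) + rscalar (a1 l m) * P (m - 1) (q + 1 + 1)
            + rscalar (a2 l m (Suc q)) * P m q"
          using rec1[of m "q + 1"] by simp
        show "P (m + 1) q = Zvar * P m q + rscalar (a1 l m) * P (m - 1) (q + 1)
            + rscalar (a2 l m q) * P m (q - 1)"
          by (rule rec1)
        show "P m (q + 1) = Zbar * P m q + rscalar (a1 l q) * P (m + 1) (q - 1)
            + rscalar (a2 l q m) * P (m - 1) q"
          by (rule IH) simp
        show "rscalar (a1 l q) * P (m + 2) (q - 1) = rscalar (a1 l q) *
            (Zvar * P (m + 1) (q - 1) + rscalar (a1 l (Suc m)) * P m q
             + rscalar (a2 l (Suc m) (q - 1)) * P (m + 1) (q - 1 - 1))"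
          using rec1[of "m + 1" "q - 1"] by (cases q) (simp_all add: rscalar_hom)
        show "rscalar (a1 l m) * P (m - 1) (q + 1 + 1) = rscalar (a1 l m) *
            (Zbar * P (m - 1) (q + 1) + rscalar (a1 l (Suc q)) * P m q
             + rscalar (a2 l (Suc q) (m - 1)) * P (m - 1 - 1) (q + 1))"
          using IH[of "m - 1" "q + 1"] by (cases m) (simp_all add: rscalar_hom)
        show "rscalar (a2 l q m) * P m q = rscalar (a2 l q m) *
            (Zvar * P (m - 1) q + rscalar (a1 l (m - 1)) * P (m - 1 - 1) (q + 1)
             + rscalar (a2 l (m - 1) q) * P (m - 1) (q - 1))"
          using rec1[of "m - 1" q] by (cases m) (simp_all add: rscalar_hom)
        show "rscalar (a2 l m q) * P m q = rscalar (a2 l m q) *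
            (Zbar * P m (q - 1) + rscalar (a1 l (q - 1)) * P (m + 1) (q - 1 - 1)
             + rscalar (a2 l (q - 1) m) * P (m - 1) (q - 1))"
          using IH[of m "q - 1"] by (cases q) (simp_all add: rscalar_hom)
        show "rscalar (a2 l q m) * rscalar (a1 l (m - 1)) =
            rscalar (a1 l m) * rscalar (a2 l (Suc q) (m - 1))"
          using id1[of q "m - 1"] by (cases m) (simp_all add: rscalar_hom)
        show "rscalar (a2 l m q) * rscalar (a1 l (q - 1)) =
            rscalar (a1 l q) * rscalar (a2 l (Suc m) (q - 1))"
          using id1[of m "q - 1"] by (cases q) (simp_all add: rscalar_hom)
        show "rscalar (a2 l q m) * rscalar (a2 l (m - 1) q) =
            rscalar (a2 l m q) * rscalar (a2 l (q - 1) m)"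
          using id2[of "q - 1" "m - 1"] by (cases m; cases q) (simp_all add: rscalar_hom)
      qed (rule id0)
      then show ?thesis by (simp add: Suc)
    qed
  qed
  then show ?thesis by (simp add: P_def l_def)
qed

end

theory Submission
  imports Defs
begin

text \<open>
  Eliminating \<open>P\<^bsub>1,n\<^esub>\<close> from the two recurrences leaves a four-term recurrence for the sequence
  \<open>P\<^bsub>0,n\<^esub>\<close> alone. On the other side, \<open>F = 1 - 3 Zbar X + 3 Z X\<^sup>2 - X\<^sup>3\<close> is a cubic, so the
  differential equations \<open>F Y' = \<beta> F' Y\<close> for \<open>Y = F\<^sup>\<beta>\<close> and \<open>F Y' = F'\<close> for \<open>Y = log F\<close> are
  four-term recurrences for the coefficients of \<open>Y\<close>. Since \<open>\<lambda> = 1 - 3 \<beta>\<close>, they agree up to the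
  scaling factors \<open>c\<^sub>n\<close>. The limits in the definition of the \<open>a\<^sub>i\<close> only matter for
  \<open>\<lambda> = 1\<close>, which is the logarithmic case.
\<close>

section \<open>\<open>scalar\<close> as a ring homomorphism, and its extension to power
  series\<close>

lemma scalar_simps:
  "scalar 0 = 0" "scalar 1 = 1" "scalar (a + b) = scalar a + scalar b"
  "scalar (a - b) = scalar a - scalar b" "scalar (- a) = - scalar a"
  "scalar (a * b) = scalar a * scalar b"
  by (simp_all add: scalar_def one_pCons)

lemma scalar_of_nat: "scalar (of_nat n) = of_nat n"
  by (induction n) (simp_all add: scalar_simps)

lemma scalar_numeral: "scalar (numeral k) = numeral k"
  using scalar_of_nat[of "numeral k"] by simp

lemma scalar_sum: "scalar (sum f A) = (\<Sum>x\<in>A. scalar (f x))"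
  by (induction A rule: infinite_finite_induct) (simp_all add: scalar_simps)

lemma scalar_fps_mult: "scalar_fps (A * B) = scalar_fps A * scalar_fps B"
  by (simp add: fps_eq_iff scalar_fps_def fps_mult_nth scalar_sum scalar_simps)

lemma scalar_fps_one_plus_X: "scalar_fps (1 + fps_X) = 1 + fps_X"
  by (simp add: fps_eq_iff scalar_fps_def fps_X_def scalar_simps)

lemma scalar_fps_const: "scalar_fps (fps_const c) = fps_const (scalar c)"
  by (simp add: fps_eq_iff scalar_fps_def scalar_simps)

lemma fps_deriv_scalar_fps: "fps_deriv (scalar_fps A) = scalar_fps (fps_deriv A)"
  by (simp add: fps_eq_iff scalar_fps_def scalar_simps scalar_of_nat[symmetric]
      del: of_nat_Suc of_nat_add)

section \<open>Differential equations for the formal power and logarithm\<close>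

lemma mult_deriv_compose:
  fixes A :: "'a :: idom fps"
  assumes "(1 + fps_X) * fps_deriv A = B" "fps_nth F 0 = 1"
  shows "F * fps_deriv (A oo (F - 1)) = (B oo (F - 1)) * fps_deriv F"
proof -
  have F0: "fps_nth (F - 1) 0 = 0" using assms by simp
  \<comment> \<open>The hypothesis concerns the outer series \<open>A\<close> alone. Substituting
    \<open>F - 1\<close> for the variable turns \<open>1 + fps_X\<close> into \<open>F\<close>, and
    the chain rule supplies \<open>fps_deriv F\<close>. The power has \<open>B\<close> a constant
    multiple of \<open>A\<close>, the logarithm has \<open>B = 1\<close>.\<close>
  have "(B oo (F - 1)) = ((1 + fps_X) oo (F - 1)) * (fps_deriv A oo (F - 1))"
    unfolding assms(1)[symmetric] by (rule fps_compose_mult_distrib[OF F0])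
  also have "((1 + fps_X) oo (F - 1)) = F"
    using F0 by (simp add: fps_compose_add_distrib)
  finally show ?thesis
    using fps_compose_deriv[OF F0, of A] by (simp add: mult_ac)
qed

text \<open>The known derivative of the binomial series contains a division by
  \<open>1 + fps_X\<close>. It is cleared over the field of complex numbers, before
  \<open>scalar_fps\<close> carries the equation to coefficients in a polynomial ring.\<close>

lemma one_plus_X_mult_divide:
  fixes A :: "'a :: field fps"
  shows "(1 + fps_X) * (A / (1 + fps_X)) = A"
proof -
  have "(1 + fps_X) * inverse (1 + fps_X :: 'a fps) = 1"
    by (simp add: inverse_mult_eq_1')
  then show ?thesis by (simp add: fps_divide_unit mult.left_commute)
qed

lemma deltoid_gen_0: "fps_nth deltoid_gen 0 = 1"
  by (simp add: deltoid_gen_def)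

lemma deltoid_gen_power_ode:
  "deltoid_gen * fps_deriv (fps_power_real deltoid_gen \<beta>) =
     fps_const (rscalar \<beta>) * fps_deriv deltoid_gen * fps_power_real deltoid_gen \<beta>"
proof -
  let ?B = "scalar_fps (fps_binomial (of_real \<beta>))"
  have "(1 + fps_X) * fps_deriv ?B = fps_const (rscalar \<beta>) * ?B"
    unfolding fps_deriv_scalar_fps scalar_fps_one_plus_X[symmetric]
      scalar_fps_const[symmetric] scalar_fps_mult[symmetric] fps_binomial_deriv
      one_plus_X_mult_divide ..
  from mult_deriv_compose[OF this deltoid_gen_0] show ?thesis
    by (simp add: fps_power_real_def fps_compose_mult_distrib deltoid_gen_0 mult_ac)
qed

lemma deltoid_gen_log_ode:
  "deltoid_gen * fps_deriv (fps_log deltoid_gen) = fps_deriv deltoid_gen"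
proof -
  have "(1 + fps_X) * fps_deriv (scalar_fps (fps_ln 1)) = 1"
    unfolding fps_deriv_scalar_fps scalar_fps_one_plus_X[symmetric]
      scalar_fps_mult[symmetric] fps_ln_deriv
    by (simp add: inverse_mult_eq_1' scalar_fps_const[of 1, simplified] scalar_simps)
  from mult_deriv_compose[OF this deltoid_gen_0] show ?thesis
    by (simp add: fps_log_def)
qed

section \<open>Recurrences for coefficients\<close>

lemma fps_deriv_deltoid_gen:
  "fps_deriv deltoid_gen =
     fps_const (- 3 * Zbar) + fps_const (6 * Zvar) * fps_X - fps_const 3 * fps_X ^ 2"
  by (simp add: deltoid_gen_def fps_deriv_power numeral_fps_const power2_eq_square mult_ac
      fps_const_neg[symmetric] del: fps_const_neg)

lemma deltoid_gen_mult_nth: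
  "fps_nth (deltoid_gen * V) 0 = fps_nth V 0"
  "fps_nth (deltoid_gen * V) 1 = fps_nth V 1 - 3 * Zbar * fps_nth V 0"
  "fps_nth (deltoid_gen * V) 2 = fps_nth V 2 - 3 * Zbar * fps_nth V 1 + 3 * Zvar * fps_nth V 0"
  "fps_nth (deltoid_gen * V) (n + 3) = fps_nth V (n + 3) - 3 * Zbar * fps_nth V (n + 2)
     + 3 * Zvar * fps_nth V (n + 1) - fps_nth V n"
proof -
  have e: "deltoid_gen * V = V - fps_const (3 * Zbar) * (fps_X * V)
      + fps_const (3 * Zvar) * (fps_X ^ 2 * V) - fps_X ^ 3 * V"
    by (simp add: deltoid_gen_def algebra_simps numeral_fps_const flip: fps_const_mult)
  show "fps_nth (deltoid_gen * V) 0 = fps_nth V 0"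
  "fps_nth (deltoid_gen * V) 1 = fps_nth V 1 - 3 * Zbar * fps_nth V 0"
  "fps_nth (deltoid_gen * V) 2 = fps_nth V 2 - 3 * Zbar * fps_nth V 1 + 3 * Zvar * fps_nth V 0"
  "fps_nth (deltoid_gen * V) (n + 3) = fps_nth V (n + 3) - 3 * Zbar * fps_nth V (n + 2)
     + 3 * Zvar * fps_nth V (n + 1) - fps_nth V n"
    by (simp_all add: e fps_X_power_mult_nth)
qed

lemma fps_deriv_deltoid_gen_mult_nth:
  "fps_nth (fps_deriv deltoid_gen * Y) 0 = - 3 * Zbar * fps_nth Y 0"
  "fps_nth (fps_deriv deltoid_gen * Y) 1 = - 3 * Zbar * fps_nth Y 1 + 6 * Zvar * fps_nth Y 0"
  "fps_nth (fps_deriv deltoid_gen * Y) (n + 2) =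
     - 3 * Zbar * fps_nth Y (n + 2) + 6 * Zvar * fps_nth Y (n + 1) - 3 * fps_nth Y n"
proof -
  have e: "fps_deriv deltoid_gen * Y = fps_const (- 3 * Zbar) * Y
      + fps_const (6 * Zvar) * (fps_X * Y) - fps_const 3 * (fps_X ^ 2 * Y)"
    unfolding fps_deriv_deltoid_gen by (simp only: ring_distribs mult_ac)
  show "fps_nth (fps_deriv deltoid_gen * Y) 0 = - 3 * Zbar * fps_nth Y 0"
  "fps_nth (fps_deriv deltoid_gen * Y) 1 = - 3 * Zbar * fps_nth Y 1 + 6 * Zvar * fps_nth Y 0"
  "fps_nth (fps_deriv deltoid_gen * Y) (n + 2) =
     - 3 * Zbar * fps_nth Y (n + 2) + 6 * Zvar * fps_nth Y (n + 1) - 3 * fps_nth Y n"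
    by (simp_all add: e fps_X_power_mult_nth)
qed

text \<open>Raising the second index brings in a polynomial with first index 1. The equation for
  \<open>Suc p\<close> at \<open>p = 0\<close>, which has no \<open>a1\<close> term, expands it
  again; hence the product of \<open>a1\<close> and \<open>a2\<close>. At index 2 the polynomial to
  expand has second index 0, so the \<open>a2\<close> term is absent as well.\<close>

lemma deltoid_poly_0_rec:
  "deltoid_poly \<alpha> 0 0 = 1"
  "deltoid_poly \<alpha> 0 1 = Zbar"
  "deltoid_poly \<alpha> 0 2 = Zbar * Zbar + rscalar (a1 (lam \<alpha>) 1) * Zvar"
  "deltoid_poly \<alpha> 0 (n + 3) = Zbar * deltoid_poly \<alpha> 0 (n + 2)
     + rscalar (a1 (lam \<alpha>) (n + 2)) * Zvar * deltoid_poly \<alpha> 0 (n + 1)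
     + rscalar (a1 (lam \<alpha>) (n + 2) * a2 (lam \<alpha>) 0 (n + 1)) * deltoid_poly \<alpha> 0 n"
  by (simp_all add: numeral_eq_Suc scalar_simps algebra_simps)

lemma deltoid_gen_mult_deriv_nth:
  "fps_nth (deltoid_gen * fps_deriv Y) 0 = fps_nth Y 1"
  "fps_nth (deltoid_gen * fps_deriv Y) 1 = 2 * fps_nth Y 2 - 3 * Zbar * fps_nth Y 1"
  "fps_nth (deltoid_gen * fps_deriv Y) (n + 2) =
     of_nat (n + 3) * fps_nth Y (n + 3) - 3 * Zbar * (of_nat (n + 2) * fps_nth Y (n + 2))
     + 3 * Zvar * (of_nat (n + 1) * fps_nth Y (n + 1)) - of_nat n * fps_nth Y n"
proof -
  show "fps_nth (deltoid_gen * fps_deriv Y) 0 = fps_nth Y 1"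
    unfolding deltoid_gen_mult_nth by simp
  show "fps_nth (deltoid_gen * fps_deriv Y) 1 = 2 * fps_nth Y 2 - 3 * Zbar * fps_nth Y 1"
    unfolding deltoid_gen_mult_nth by (simp add: numeral_2_eq_2)
  show "fps_nth (deltoid_gen * fps_deriv Y) (n + 2) =
     of_nat (n + 3) * fps_nth Y (n + 3) - 3 * Zbar * (of_nat (n + 2) * fps_nth Y (n + 2))
     + 3 * Zvar * (of_nat (n + 1) * fps_nth Y (n + 1)) - of_nat n * fps_nth Y n"
  \<comment> \<open>For \<open>n = 0\<close> no coefficient of the derivative corresponds to the
    last term, but its factor \<open>of_nat n\<close> vanishes, so one formula covers both
    cases.\<close>
  proof (cases n)
    case 0
    then show ?thesis
      using deltoid_gen_mult_nth(3)[of "fps_deriv Y"] by (simp add: numeral_eq_Suc)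
  next
    case (Suc m)
    then show ?thesis
      using deltoid_gen_mult_nth(4)[of "fps_deriv Y" m] by (simp add: numeral_eq_Suc)
  qed
qed

lemma induct_three_step [case_names 0 1 2 step]:
  fixes n :: nat
  assumes "Q 0" "Q 1" "Q 2" "\<And>n. Q n \<Longrightarrow> Q (n + 1) \<Longrightarrow> Q (n + 2) \<Longrightarrow> Q (n + 3)"
  shows "Q n"
proof -
  have "Q n \<and> Q (n + 1) \<and> Q (n + 2)"
    by (induction n) (use assms in \<open>auto simp: numeral_eq_Suc\<close>)
  then show ?thesis ..
qed

section \<open>The power case\<close>

lemma deltoid_power_coeff:
  assumes "\<alpha> > - 5 / 6" "\<beta> = - (1 + 2 * \<alpha>) / 2" "\<alpha> \<noteq> - 1 / 2"
  shows "fps_nth (fps_power_real deltoid_gen \<beta>) n =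
     rscalar ((- 3) ^ n * (\<Prod>i<n. \<beta> - real i) / fact n) * deltoid_poly \<alpha> 0 n"
proof -
  define l where "l = lam \<alpha>"
  define c where "c n = (- 3) ^ n * (\<Prod>i<n. \<beta> - real i) / fact n" for n
  define P where "P = deltoid_poly \<alpha> 0"
  define Y where "Y = fps_nth (fps_power_real deltoid_gen \<beta>)"
  have l: "l = 1 - 3 * \<beta>" and \<beta>: "\<beta> < 1 / 3" "\<beta> \<noteq> 0"
    using assms by (simp_all add: l_def lam_def field_simps)
  have c_Suc: "real (n + 1) * c (n + 1) = 3 * (real n - \<beta>) * c n" for n
    by (simp add: c_def divide_simps) (simp add: algebra_simps)
  have c0: "c 0 = 1" by (simp add: c_def)
  have c1: "c 1 = - 3 * \<beta>" by (simp add: c_def)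
  \<comment> \<open>For \<open>n = 0\<close> this is \<beta> \<noteq> 0, for larger \<open>n\<close>
    it follows from \<beta> < 1/3. Thus no denominator of the \<open>a1\<close> and
    \<open>a2\<close> values below vanishes, and the plain expressions apply.\<close>
  have nz: "real n - \<beta> \<noteq> 0" "real n - 2 * \<beta> \<noteq> 0" for n
    using \<beta> by (cases n; simp)+
  have d: "l + 3 * real (n + 1) - 1 = 3 * (real (n + 1) - \<beta>)"
    "l + 3 * real (n + 1) - 4 = 3 * (real n - \<beta>)"
    "3 * real (n + 1) + 2 * l - 5 = 3 * (real n - 2 * \<beta>)"
    "2 * l + 3 * real (n + 1) - 5 = 3 * (real n - 2 * \<beta>)"
    "2 * l + 3 * real (n + 1) - 2 = 3 * (real (n + 1) - 2 * \<beta>)"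
    "l + real (n + 1) - 2 = real n - 3 * \<beta>" for n
    by (simp_all add: l)
  have a1: "a1 l (n + 1) =
      - (real (n + 1) * (real n - 2 * \<beta>)) / (3 * (real (n + 1) - \<beta>) * (real n - \<beta>))" for n
    unfolding a1_def a1_expr_def d using nz[of n] nz[of "n + 1"]
    by (simp del: of_nat_add right_diff_distrib_numeral)
  have a2: "a2 l 0 (n + 1) = - (real (n + 1) * (real n - 3 * \<beta>)) /
      (9 * (real (n + 1) - 2 * \<beta>) * (real n - \<beta>))" for n
    unfolding a2_def a2_expr_def of_nat_0 add_0_left add_0_right d using nz[of n] nz[of "n + 1"]
    by (simp del: of_nat_add right_diff_distrib_numeral)
  have c_Suc': "real (n + 2) * c (n + 2) =
      9 * (real (n + 1) - \<beta>) * (real n - \<beta>) * c n / real (n + 1)" for n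
    using c_Suc[of "n + 1"] c_Suc[of n] by (simp add: divide_simps) algebra
  \<comment> \<open>Multiplying the recurrence for \<open>P (n + 3)\<close> by
    \<open>(n + 3) * c (n + 3)\<close> must produce \<open>Y3\<close>. The \<open>Zbar\<close>
    coefficients agree by \<open>c_Suc\<close>, the \<open>Zvar\<close> coefficients by
    \<open>coeff1\<close> at \<open>n + 1\<close>, and the last ones by
    \<open>coeff2\<close>.\<close>
  have coeff1: "real (n + 2) * c (n + 2) * a1 l (n + 1) = - 3 * (real n - 2 * \<beta>) * c n" for n
    unfolding c_Suc' a1 using nz[of n] nz[of "n + 1"]
    by (simp del: of_nat_add right_diff_distrib_numeral)
  have coeff2: "real (n + 3) * c (n + 3) * (a1 l (n + 2) * a2 l 0 (n + 1)) =
      (real n - 3 * \<beta>) * c n" for n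
  proof -
    have e: "n + 1 + 2 = n + 3" "n + 1 + 1 = n + 2" by simp_all
    have "real (n + 3) * c (n + 3) * (a1 l (n + 2) * a2 l 0 (n + 1)) =
        - 3 * (real (n + 1) - 2 * \<beta>) * c (n + 1) * a2 l 0 (n + 1)"
      using coeff1[of "n + 1", unfolded e] by (simp only: mult.assoc[symmetric])
    also have "\<dots> = real (n + 1) * c (n + 1) * (real n - 3 * \<beta>) / (3 * (real n - \<beta>))"
      unfolding a2 using nz[of n] nz[of "n + 1"]
      by (simp del: of_nat_add right_diff_distrib_numeral)
    finally show ?thesis
      unfolding c_Suc using nz[of n] by simp
  qed
  have Y0: "Y 0 = 1"
    by (simp add: Y_def fps_power_real_def scalar_fps_def scalar_simps)
  have ode: "fps_nth (deltoid_gen * fps_deriv (fps_power_real deltoid_gen \<beta>)) n =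
      rscalar \<beta> * fps_nth (fps_deriv deltoid_gen * fps_power_real deltoid_gen \<beta>) n" for n
    by (simp add: deltoid_gen_power_ode mult.assoc)
  have Y1: "Y 1 = - 3 * rscalar \<beta> * Zbar"
    using ode[of 0] Y0
    unfolding deltoid_gen_mult_deriv_nth fps_deriv_deltoid_gen_mult_nth Y_def[symmetric]
    by (simp add: mult_ac)
  have Y2: "2 * Y 2 = 3 * (1 - rscalar \<beta>) * Zbar * Y 1 + 6 * rscalar \<beta> * Zvar"
    using ode[of 1] Y0 unfolding deltoid_gen_mult_deriv_nth fps_deriv_deltoid_gen_mult_nth Y_def[symmetric]
    by (simp add: algebra_simps)
  have Y3: "of_nat (n + 3) * Y (n + 3) = 3 * (of_nat (n + 2) - rscalar \<beta>) * Zbar * Y (n + 2)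
      - 3 * (of_nat (n + 1) - 2 * rscalar \<beta>) * Zvar * Y (n + 1)
      + (of_nat n - 3 * rscalar \<beta>) * Y n" for n
    using ode[of "n + 2"]
    unfolding deltoid_gen_mult_deriv_nth fps_deriv_deltoid_gen_mult_nth Y_def[symmetric]
    by algebra
  note P = deltoid_poly_0_rec[of \<alpha>, folded P_def l_def]
  have lift: "rscalar x = rscalar y" if "x = y" for x y using that by simp
  have "Y n = rscalar (c n) * P n"
  proof (induction n rule: induct_three_step)
    case 0
    show ?case by (simp add: Y0 P c0 scalar_simps)
  next
    case 1
    show ?case
      unfolding Y1 P c1 by (simp add: scalar_simps scalar_numeral)
  next
    case 2
    have "2 * rscalar (c 2) = 3 * (1 - rscalar \<beta>) * rscalar (c 1)"
      using lift[OF c_Suc[of 1]] by (simp add: scalar_simps scalar_numeral numeral_2_eq_2)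
    moreover have "2 * rscalar (c 2) * rscalar (a1 l 1) = 6 * rscalar \<beta>"
      using lift[OF coeff1[of 0]] by (simp add: scalar_simps scalar_numeral numeral_2_eq_2 c0)
    moreover have "rscalar (c 1) = - 3 * rscalar \<beta>"
      by (simp add: c1 scalar_simps scalar_numeral del: One_nat_def)
    ultimately have "2 * Y 2 = 2 * (rscalar (c 2) * P 2)"
      using Y2 unfolding Y1 P by algebra
    then show ?case by simp
  next
    case (step n)
    have e: "n + 2 + 1 = n + 3" "n + 1 + 2 = n + 3" "n + 1 + 1 = n + 2" by simp_all
    note push = scalar_simps scalar_numeral scalar_of_nat of_real_mult of_real_diff of_real_minus
      of_real_numeral of_real_of_nat_eq
    have c3: "of_nat (n + 3) * rscalar (c (n + 3)) =
        3 * (of_nat (n + 2) - rscalar \<beta>) * rscalar (c (n + 2))"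
      using lift[OF c_Suc[of "n + 2", unfolded e]] by (simp only: push)
    have k1: "of_nat (n + 3) * rscalar (c (n + 3)) * rscalar (a1 l (n + 2)) =
        - 3 * (of_nat (n + 1) - 2 * rscalar \<beta>) * rscalar (c (n + 1))"
      using lift[OF coeff1[of "n + 1", unfolded e]] by (simp only: push)
    have k2: "of_nat (n + 3) * rscalar (c (n + 3)) * rscalar (a1 l (n + 2) * a2 l 0 (n + 1)) =
        (of_nat n - 3 * rscalar \<beta>) * rscalar (c n)"
      using lift[OF coeff2[of n]] by (simp only: push)
    \<comment> \<open>The differential equation yields \<open>Y (n + 3)\<close> only multiplied by
      \<open>n + 3\<close>. This factor is cancelled at the end, since the polynomial ring is an
      integral domain of characteristic 0.\<close>
    have "of_nat (n + 3) * Y (n + 3) = of_nat (n + 3) * (rscalar (c (n + 3)) * P (n + 3))"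
      using Y3[of n] c3 k1 k2 unfolding P step by algebra
    then show ?case
      by (simp del: of_nat_add)
  qed
  then show ?thesis by (simp add: Y_def c_def P_def)
qed

section \<open>The logarithmic case\<close>

lemma lam_1_coeffs:
  "a1 1 1 = - 2 / 3" "a1 1 (n + 2) = - 1 / 3" "a2 1 0 1 = - 1 / 3" "a2 1 0 (n + 2) = - 1 / 9"
proof -
  \<comment> \<open>At \<lambda> = 1 + \<epsilon> and \<open>p = 1\<close> the numerator factor
    \<open>2 * \<epsilon>\<close> meets the denominator factor \<open>\<epsilon>\<close>, so the
    limit is twice the value -1/3 found at all later indices.\<close>
  have "((\<lambda>\<epsilon>::real. - 2 / (3 + \<epsilon>)) \<longlongrightarrow> - 2 / (3 + 0)) (at 0)"
    by (intro tendsto_intros) auto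
  moreover have "eventually (\<lambda>\<epsilon>. - 2 / (3 + \<epsilon>) = a1_expr (1 + \<epsilon>) 1) (at 0)"
    using eventually_neq_at_within[of 0]
    by eventually_elim (simp add: a1_expr_def)
  ultimately have "((\<lambda>\<epsilon>. a1_expr (1 + \<epsilon>) 1) \<longlongrightarrow> - 2 / (3 + 0)) (at 0)"
    by (rule Lim_transform_eventually)
  then show "a1 1 1 = - 2 / 3"
    using tendsto_unique[OF _ tendsto_a1[of 1 1]] by fastforce
  \<comment> \<open>Two factors vanish at \<epsilon> = 0 both above and below the fraction bar.
    Displaying the common factors lets them cancel when \<epsilon> is neither 0 nor -3.\<close>
  have a2_eq: "a2_expr (1 + \<epsilon>) 0 1 =
      ((3 + \<epsilon>) * (2 * \<epsilon>) * \<epsilon> * - 1) / ((3 + \<epsilon>) * (2 * \<epsilon>) * \<epsilon> * (3 + 2 * \<epsilon>))" for \<epsilon>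
    unfolding a2_expr_def of_nat_0 of_nat_1 by (rule arg_cong2[where f = "(/)"]) algebra+
  have "((\<lambda>\<epsilon>::real. - 1 / (3 + 2 * \<epsilon>)) \<longlongrightarrow> - 1 / (3 + 2 * 0)) (at 0)"
    by (intro tendsto_intros) auto
  moreover have "eventually (\<lambda>\<epsilon>. - 1 / (3 + 2 * \<epsilon>) = a2_expr (1 + \<epsilon>) 0 1) (at 0)"
    using eventually_neq_at_within[of 0] eventually_neq_at_within[of "- 3"]
    by eventually_elim (simp add: a2_eq add_eq_0_iff del: One_nat_def)
  ultimately have "((\<lambda>\<epsilon>. a2_expr (1 + \<epsilon>) 0 1) \<longlongrightarrow> - 1 / (3 + 2 * 0)) (at 0)"
    by (rule Lim_transform_eventually)
  then show "a2 1 0 1 = - 1 / 3"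
    using tendsto_unique[OF _ tendsto_a2[of 1 0 1]] by fastforce
  have d: "1 + 3 * real (n + 2) - 1 = 3 * real (n + 2)" "1 + 3 * real (n + 2) - 4 = 3 * real (n + 1)"
    "3 * real (n + 2) + 2 * 1 - 5 = 3 * real (n + 1)" "1 + real (n + 2) - 2 = real (n + 1)"
    "2 * 1 + 3 * real (n + 2) - 5 = 3 * real (n + 1)" "2 * 1 + 3 * real (n + 2) - 2 = 3 * real (n + 2)"
    by simp_all
  show "a1 1 (n + 2) = - 1 / 3"
    unfolding a1_def a1_expr_def d by (simp del: of_nat_add)
  show "a2 1 0 (n + 2) = - 1 / 9"
    unfolding a2_def a2_expr_def of_nat_0 add_0_left add_0_right d
    by (simp add: divide_simps del: of_nat_add distrib_left_numeral)
qed

text \<open>The equation for the logarithm determines \<open>n\<close> times the \<open>n\<close>-th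
  coefficient, and with this factor kept no division is required in the polynomial ring. For large
  indices the coefficients -1/3 and 1/27 of the polynomial recurrence, rescaled by the powers of 3,
  become the -3 and 1 of the differential equation.\<close>

lemma deltoid_log_coeff:
  "of_nat n * fps_nth (fps_log deltoid_gen) n =
     (if n = 0 then 0 else - (3 ^ n) * deltoid_poly (- 1 / 2) 0 n)"
proof -
  define P where "P = deltoid_poly (- 1 / 2) 0"
  define Y where "Y = fps_nth (fps_log deltoid_gen)"
  have l: "lam (- 1 / 2) = 1" by (simp add: lam_def)
  note P = deltoid_poly_0_rec[of "- 1 / 2", folded P_def, unfolded l]
  have third: "3 * rscalar (- 1 / 3) = - 1"
    unfolding scalar_numeral[symmetric] scalar_simps[symmetric] by simp
  \<comment> \<open>The factor \<open>1\<close> makes the coefficient formulas for a product with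
    \<open>fps_deriv deltoid_gen\<close> applicable.\<close>
  have ode: "fps_nth (deltoid_gen * fps_deriv (fps_log deltoid_gen)) n =
      fps_nth (fps_deriv deltoid_gen * 1) n" for n
    by (simp add: deltoid_gen_log_ode)
  have Y1: "Y 1 = - 3 * Zbar"
    using ode[of 0] unfolding deltoid_gen_mult_deriv_nth fps_deriv_deltoid_gen_mult_nth Y_def[symmetric]
    by simp
  have Y2: "2 * Y 2 = 3 * Zbar * Y 1 + 6 * Zvar"
    using ode[of 1] unfolding deltoid_gen_mult_deriv_nth fps_deriv_deltoid_gen_mult_nth Y_def[symmetric]
    by (simp add: algebra_simps)
  \<comment> \<open>The last term is the quadratic term of \<open>fps_deriv deltoid_gen\<close>; it
    is nonzero only for \<open>n = 0\<close>.\<close>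
  have Y3: "of_nat (n + 3) * Y (n + 3) = 3 * Zbar * (of_nat (n + 2) * Y (n + 2))
      - 3 * Zvar * (of_nat (n + 1) * Y (n + 1)) + of_nat n * Y n
      - 3 * fps_nth (1 :: complex poly poly fps) n" for n
  proof -
    have "fps_nth (1 :: complex poly poly fps) (n + 1) = 0" "fps_nth (1 :: complex poly poly fps) (n + 2) = 0"
      by simp_all
    then show ?thesis
      using ode[of "n + 2"]
      unfolding deltoid_gen_mult_deriv_nth fps_deriv_deltoid_gen_mult_nth Y_def[symmetric]
      by algebra
  qed
  have "of_nat n * Y n = (if n = 0 then 0 else - (3 ^ n) * P n)"
  proof (induction n rule: induct_three_step)
    case 0
    show ?case by simp
  next
    case 1
    show ?case by (simp add: Y1 P del: One_nat_def)
  next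
    case 2
    \<comment> \<open>The exceptional value -2/3 of \<open>a1\<close> matches the
      \<open>6 * Zvar\<close> in \<open>Y2\<close>.\<close>
    have "3 * rscalar (a1 1 1) = - 2"
      unfolding scalar_numeral[symmetric] scalar_simps[symmetric] lam_1_coeffs
      by simp
    then have "2 * Y 2 = - (9 * P 2)"
      using Y2 unfolding Y1 P by algebra
    then show ?case by simp
  next
    case (step n)
    have a: "3 * rscalar (a1 1 (n + 2)) = - 1"
      by (simp only: lam_1_coeffs third)
    show ?case
    proof (cases n)
      case 0
      \<comment> \<open>Here the product is 1/9 rather than 1/27, because \<open>a2 1 0 1\<close> is
        exceptional. This accounts for the extra -3 in \<open>Y3\<close>, which stands in for the
        vanishing \<open>of_nat n * Y n\<close>.\<close>
      have b: "9 * rscalar (a1 1 2 * a2 1 0 1) = 1"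
        unfolding scalar_numeral[symmetric] scalar_simps[symmetric] lam_1_coeffs
          lam_1_coeffs(2)[of 0, unfolded add_0] by simp
      have "P 3 = Zbar * P 2 + rscalar (a1 1 2) * Zvar * P 1 + rscalar (a1 1 2 * a2 1 0 1) * P 0"
        using P(4)[of 0, unfolded add_0] .
      moreover have "3 * Y 3 = 3 * Zbar * (2 * Y 2) - 3 * Zvar * Y 1 - 3"
        using Y3[of 0, unfolded add_0] by simp
      moreover have "2 * Y 2 = - (9 * P 2)"
        using step(3)[unfolded 0 add_0] by simp
      moreover have "Y 1 = - (3 * P 1)"
        by (simp add: Y1 P(2) del: One_nat_def)
      ultimately have "3 * Y 3 = - (27 * P 3)"
        using a[unfolded 0 add_0] b P(1) by algebra
      then show ?thesis using 0 by simp
    next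
      case (Suc m)
      have b: "27 * rscalar (a1 1 (n + 2) * a2 1 0 (n + 1)) = 1"
        unfolding scalar_numeral[symmetric] scalar_simps[symmetric] lam_1_coeffs
        using lam_1_coeffs(4)[of m] Suc by simp
      have n: "of_nat n * Y n = - (3 ^ n * P n)"
        "of_nat (n + 1) * Y (n + 1) = - (3 * 3 ^ n * P (n + 1))"
        "of_nat (n + 2) * Y (n + 2) = - (9 * 3 ^ n * P (n + 2))"
        using step Suc by (simp_all add: algebra_simps)
      define t :: "complex poly poly" where "t = 3 ^ n"
      have z: "fps_nth (1 :: complex poly poly fps) n = 0"
        using Suc by simp
      have "of_nat (n + 3) * Y (n + 3) = - (27 * 3 ^ n * P (n + 3))"
        unfolding P Y3 n z t_def[symmetric] using a b by algebra
      then show ?thesis by (simp add: power_add)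
    qed
  qed
  then show ?thesis by (simp add: Y_def P_def)
qed

theorem corollary8p3:
  fixes \<alpha> \<beta> :: real
  assumes "\<alpha> > - 5 / 6" and "\<beta> = - (1 + 2 * \<alpha>) / 2"
  shows "(\<alpha> \<noteq> - 1 / 2 \<longrightarrow>
            fps_power_real deltoid_gen \<beta> =
              Abs_fps (\<lambda>n. scalar (of_real ((- 3) ^ n * (\<Prod>i<n. \<beta> - real i) / fact n))
                            * deltoid_poly \<alpha> 0 n))
       \<and> (\<alpha> = - 1 / 2 \<longrightarrow>
            (\<exists>c :: nat \<Rightarrow> complex. (\<forall>n\<ge>1. c n \<noteq> 0) \<and>
              fps_log deltoid_gen =
                Abs_fps (\<lambda>n. if n = 0 then 0 else scalar (c n) * deltoid_poly (- 1 / 2) 0 n)))"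
proof (intro conjI impI)
  assume "\<alpha> \<noteq> - 1 / 2"
  then show "fps_power_real deltoid_gen \<beta> =
              Abs_fps (\<lambda>n. scalar (of_real ((- 3) ^ n * (\<Prod>i<n. \<beta> - real i) / fact n))
                            * deltoid_poly \<alpha> 0 n)"
    by (intro fps_ext) (simp only: fps_nth_Abs_fps deltoid_power_coeff[OF assms] not_False_eq_True)
next
  \<comment> \<open>These constants are forced by \<open>deltoid_log_coeff\<close>; they are also
    the limits, as \<beta> tends to 0, of the constants of the power case divided by
    \<beta>.\<close>
  define c :: "nat \<Rightarrow> complex" where "c n = - (3 ^ n) / of_nat n" for n
  have "fps_nth (fps_log deltoid_gen) n =
      (if n = 0 then 0 else scalar (c n) * deltoid_poly (- 1 / 2) 0 n)" for n
  proof (cases "n = 0")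
    case True
    then show ?thesis
      by (simp add: fps_log_def scalar_fps_def fps_ln_def scalar_simps)
  next
    case False
    \<comment> \<open>The division by \<open>n\<close> takes place in the complex numbers; in the
      polynomial ring the factor \<open>n\<close> is only cancelled.\<close>
    have "of_nat n * scalar (c n) = scalar (- (3 ^ n))"
      using False by (simp add: c_def scalar_of_nat[symmetric] scalar_simps(6)[symmetric])
    also have "\<dots> = - (3 ^ n)"
      using scalar_of_nat[of "3 ^ n"] by (simp add: scalar_simps)
    finally have "of_nat n * (scalar (c n) * deltoid_poly (- 1 / 2) 0 n) =
        of_nat n * fps_nth (fps_log deltoid_gen) n"
      using False by (simp add: deltoid_log_coeff flip: mult.assoc)
    then show ?thesis using False by simp
  qed
  moreover have "\<forall>n\<ge>1. c n \<noteq> 0"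
    by (simp add: c_def)
  ultimately show "\<exists>c :: nat \<Rightarrow> complex. (\<forall>n\<ge>1. c n \<noteq> 0) \<and>
              fps_log deltoid_gen =
                Abs_fps (\<lambda>n. if n = 0 then 0 else scalar (c n) * deltoid_poly (- 1 / 2) 0 n)"
    by (intro exI[of _ c] conjI fps_ext) simp_all
qed

end
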